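(* Assume: $F:C_\mu\to H$ is globally Lipschitz continuous, with constants $\bar C_F\ge0$, $C_F>0$ such that $|F(x)|\le\bar C_F+C_F\|x\|_\mu$ for $x\in C_\mu$; $G$ maps $C_\mu$ into $L(U;D((-A)^\nu))$ for some $\nu\in(0,1)$, is Lipschitz continuous with values in that space, and satisfies $\|G(x)\|_{L(U;D((-A)^\nu))}\le C_{G,\nu}$ and $\|G(x)\|_{L(U;H)}\le C_G$ for all $x\in C_\mu$; there is a Lipschitz continuous $K:C_\mu\to L(U;H)$ with $\|K(x)\|_{L(U;H)}\le C_K$ for all $x\in C_\mu$, such that for every $T>0$ and $u\in C([-\mu,T];H)$ the mapping $t\mapsto G(u_t)$ is in $C^1([0,T];L(U;H))$ with $\frac{d}{dt}G(u_t)=K(u_t)$; and $\mu<\frac1\lambda\log\big(\frac{\lambda}{C_F}\big)$. Let $\delta>0$ be a constant, and for $\omega\in\Omega$ put $$\begin{aligned}R(\omega)={}&C_G\|\omega_0\|_\mu+\frac{\bar C_Fe^{\lambda\mu}}{\lambda}+C_Ke^{\lambda\mu}\int_{-\infty}^0e^{\lambda r}\|\omega_r\|_\mu\,dr+C_{G,\nu}\int_{-\infty}^0\frac{e^{\lambda r}}{(-r)^{1-\nu}}\|\omega_r\|_\mu\,dr\\&+C_Fe^{\lambda\mu}\Big[C_G\int_{-\infty}^0e^{(\lambda-C_Fe^{\lambda\mu})r}\|\omega_r\|_\mu\,dr+\frac{\bar C_Fe^{\lambda\mu}}{\lambda(\lambda-C_Fe^{\lambda\mu})}\\&\quad+\frac1{\lambda-C_Fe^{\lambda\mu}}\Big(C_Ke^{\lambda\mu}\int_{-\infty}^0e^{\lambda\tau}\|\omega_\tau\|_\mu\,d\tau+C_{G,\nu}\int_{-\infty}^0\frac{e^{\lambda\tau}}{(-\tau)^{1-\nu}}\|\omega_\tau\|_\mu\,d\tau\Big)\Big].\end{aligned}$$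 Then the family of balls $B=(B(\omega))_{\omega\in\Omega}$, where $B(\omega)$ is the ball in $C_\mu$ with center $0$ and radius $\rho(\omega)=R(\omega)+\delta$, belongs to $\mathcal{D}$.
   Context: $H$ and $U$ are separable Hilbert spaces with norms $|\cdot|$ and $|\cdot|_U$. Fix $\mu>0$; $C_\mu=C([-\mu,0];H)$ with sup norm $\|\cdot\|_\mu$. For $u\in C([-\mu,T];H)$ and $t\in[0,T]$, $u_t\in C_\mu$ is defined by $u_t(s)=u(t+s)$, $s\in[-\mu,0]$. Likewise, for a path $\omega:\mathbb{R}\to U$ and $r\in\mathbb{R}$, $\|\omega_r\|_\mu=\sup_{s\in[-\mu,0]}|\omega(r+s)|_U$. Balls are closed. $-A$ is a strictly positive symmetric (self-adjoint) operator on $H$ with compact inverse, and $A$ generates an analytic $C_0$-semigroup $S=(S(t))_{t\ge0}$ on $H$. $D((-A)^\gamma)$, $\gamma\ge0$, are the domains of the fractional powers with their usual norms. The number $\lambda>0$ is such that for $t>0$ (constants normalized to $1$): $|S(t)|\le e^{-\lambda t}$; $|(-A)^\gamma S(t)|_{L(H)}\le t^{-\gamma}e^{-\lambda t}$ for $\gamma\in[0,1)$; $|S(t)-\mathrm{id}|_{L(D((-A)^\sigma),D((-A)^\theta))}\le t^{\sigma-\theta}$ for $\theta\ge0$, $\sigma\in[\theta,1+\theta]$. Noise: $C_0(\mathbb{R};U)$ is the space of continuous functions $\mathbb{R}\to U$ vanishing at $0$ with the compact-open topology, carrying the Wiener measure $\mathbb{P}$ with trace-class covariance operator $Q$; $\theta_t\omega(\cdot)=\omega(\cdot+t)-\omega(t)$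 is the Wiener shift. Fix $\beta\in(0,1/2)$. $\Omega$ is a fixed $(\theta_t)$-invariant measurable set of full measure consisting of $\omega\in C_0(\mathbb{R};U)$ with finite $\beta$-Hölder seminorm on every $[-k,k]$, $k\in\mathbb{N}$, and such that for every $\omega\in\Omega$ and $a<0$, $\lim_{t\to\pm\infty}\frac1{|t|}\sup_{a\le s\le0}|\theta_t\omega(s)|_U=0$ (such a set exists). $\mathcal{F}$ is the trace Borel $\sigma$-algebra on $\Omega$, and $\mathbb{P}$ is restricted to it. $\mathcal{D}$ is the collection of families $D=(D(\omega))_{\omega\in\Omega}$ of nonempty closed sets $D(\omega)\subset C_\mu$ such that $\omega\mapsto\inf_{x\in D(\omega)}\|x-y\|_\mu$ is a random variable for every $y\in C_\mu$ and $\lim_{t\to\pm\infty}\frac{1}{|t|}\log^+\sup_{x\in D(\theta_t\omega)}\|x\|_\mu=0$ for all $\omega\in\Omega$ (convention $\log^+0=0$). *)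

theory Defs
  imports "HOL-Probability.Probability"
begin

section \<open>The space of histories\<close>

definition sup_norm :: "real \<Rightarrow> (real \<Rightarrow> 'a::real_normed_vector) \<Rightarrow> real" where
  "sup_norm \<mu> x = (SUP s\<in>{-\<mu>..0}. norm (x s))"

text \<open>An element of \<open>C([-\<mu>,0];H)\<close> is a function that is \<open>undefined\<close> off \<open>[-\<mu>,0]\<close>, so that equality
  of elements is equality of functions.\<close>

definition C_space :: "real \<Rightarrow> (real \<Rightarrow> 'a::real_normed_vector) set" where
  "C_space \<mu> = {x \<in> extensional {-\<mu>..0}. continuous_on {-\<mu>..0} x}"

text \<open>The guard in the distance is needed because \<^const>\<open>metric\<close> wants a distance that is nonnegative
  on the whole type; it plays no role on the carrier, see the two simplification rules below.\<close>

definition C_metric :: "real \<Rightarrow> (real \<Rightarrow> 'a::real_normed_vector) metric" where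
  "C_metric \<mu> = metric (C_space \<mu>,
     \<lambda>x y. if x \<in> C_space \<mu> \<and> y \<in> C_space \<mu> then sup_norm \<mu> (\<lambda>s. x s - y s) else 0)"

lemma bdd_above_norm_C_space:
  fixes x :: "real \<Rightarrow> 'a::real_normed_vector"
  assumes "continuous_on {-\<mu>..0} x"
  shows "bdd_above ((\<lambda>s. norm (x s)) ` {-\<mu>..0})"
proof -
  have "compact ((\<lambda>s. norm (x s)) ` {-\<mu>..0})"
    by (intro compact_continuous_image continuous_on_norm assms) simp
  then show ?thesis
    by (simp add: bounded_imp_bdd_above compact_imp_bounded)
qed

lemma norm_le_sup_norm:
  assumes "continuous_on {-\<mu>..0} x" "s \<in> {-\<mu>..0}"
  shows "norm (x s) \<le> sup_norm \<mu> x"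
  unfolding sup_norm_def by (rule cSUP_upper[OF assms(2) bdd_above_norm_C_space[OF assms(1)]])

lemma Metric_space_C_metric:
  assumes "0 \<le> \<mu>"
  shows "Metric_space (C_space \<mu>)
     (\<lambda>x y. if x \<in> C_space \<mu> \<and> y \<in> C_space \<mu> then sup_norm \<mu> (\<lambda>s. x s - y s :: 'a::real_normed_vector) else 0)"
proof
  have cont: "continuous_on {-\<mu>..0} (\<lambda>s. x s - y s)" if "x \<in> C_space \<mu>" "y \<in> C_space \<mu>"
    for x y :: "real \<Rightarrow> 'a"
    using that by (auto simp: C_space_def intro!: continuous_on_diff)
  have nonneg: "0 \<le> sup_norm \<mu> (\<lambda>s. x s - y s)" if "x \<in> C_space \<mu>" "y \<in> C_space \<mu>"
    for x y :: "real \<Rightarrow> 'a"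
  proof -
    have "norm (x 0 - y 0) \<le> sup_norm \<mu> (\<lambda>s. x s - y s)"
      by (rule norm_le_sup_norm[OF cont[OF that]]) (simp add: assms)
    then show ?thesis
      by (rule order_trans[OF norm_ge_zero])
  qed
  fix x y :: "real \<Rightarrow> 'a"
  show "0 \<le> (if x \<in> C_space \<mu> \<and> y \<in> C_space \<mu> then sup_norm \<mu> (\<lambda>s. x s - y s) else 0)"
    using nonneg by auto
  show "(if x \<in> C_space \<mu> \<and> y \<in> C_space \<mu> then sup_norm \<mu> (\<lambda>s. x s - y s) else 0)
      = (if y \<in> C_space \<mu> \<and> x \<in> C_space \<mu> then sup_norm \<mu> (\<lambda>s. y s - x s) else 0)"
    by (auto simp: sup_norm_def norm_minus_commute)
  assume x: "x \<in> C_space \<mu>" and y: "y \<in> C_space \<mu>"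
  have "x = y" if "sup_norm \<mu> (\<lambda>s. x s - y s) = 0"
  proof (rule extensionalityI[of _ "{-\<mu>..0}"])
    show "x \<in> extensional {-\<mu>..0}" "y \<in> extensional {-\<mu>..0}"
      using x y by (auto simp: C_space_def)
    show "x s = y s" if "s \<in> {-\<mu>..0}" for s
      using norm_le_sup_norm[OF cont[OF x y] that] \<open>sup_norm \<mu> _ = 0\<close> by simp
  qed
  moreover have "sup_norm \<mu> (\<lambda>s. x s - x s) = 0"
    using assms by (simp add: sup_norm_def)
  ultimately show "(if x \<in> C_space \<mu> \<and> y \<in> C_space \<mu> then sup_norm \<mu> (\<lambda>s. x s - y s) else 0) = 0
      \<longleftrightarrow> x = y"
    using x y by auto
  fix z :: "real \<Rightarrow> 'a"
  assume z: "z \<in> C_space \<mu>"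
  have "sup_norm \<mu> (\<lambda>s. x s - z s) \<le> sup_norm \<mu> (\<lambda>s. x s - y s) + sup_norm \<mu> (\<lambda>s. y s - z s)"
    unfolding sup_norm_def[of \<mu> "\<lambda>s. x s - z s"]
  proof (rule cSUP_least)
    show "{-\<mu>..0} \<noteq> {}" using assms by simp
    fix s assume s: "s \<in> {-\<mu>..0}"
    have "norm (x s - z s) \<le> norm (x s - y s) + norm (y s - z s)"
      using norm_triangle_ineq[of "x s - y s" "y s - z s"] by simp
    with norm_le_sup_norm[OF cont[OF x y] s] norm_le_sup_norm[OF cont[OF y z] s]
    show "norm (x s - z s) \<le> sup_norm \<mu> (\<lambda>s. x s - y s) + sup_norm \<mu> (\<lambda>s. y s - z s)"
      by linarith
  qed
  then show "(if x \<in> C_space \<mu> \<and> z \<in> C_space \<mu> then sup_norm \<mu> (\<lambda>s. x s - z s) else 0)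
     \<le> (if x \<in> C_space \<mu> \<and> y \<in> C_space \<mu> then sup_norm \<mu> (\<lambda>s. x s - y s) else 0)
      + (if y \<in> C_space \<mu> \<and> z \<in> C_space \<mu> then sup_norm \<mu> (\<lambda>s. y s - z s) else 0)"
    using x y z by simp
qed

lemma mspace_C_metric [simp]: "0 \<le> \<mu> \<Longrightarrow> mspace (C_metric \<mu>) = C_space \<mu>"
  by (simp add: C_metric_def Metric_space.mspace_metric Metric_space_C_metric)

lemma mdist_C_metric [simp]:
  "0 \<le> \<mu> \<Longrightarrow> x \<in> C_space \<mu> \<Longrightarrow> y \<in> C_space \<mu> \<Longrightarrow>
     mdist (C_metric \<mu>) x y = sup_norm \<mu> (\<lambda>s. x s - y s)"
  by (simp add: C_metric_def Metric_space.mdist_metric Metric_space_C_metric)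

text \<open>The segment \<open>u\<^sub>t\<close>.\<close>

definition segment :: "real \<Rightarrow> (real \<Rightarrow> 'a) \<Rightarrow> real \<Rightarrow> (real \<Rightarrow> 'a)" where
  "segment \<mu> u t = restrict (\<lambda>s. u (t + s)) {-\<mu>..0}"

section \<open>Operators and semigroups\<close>

text \<open>Unbounded operators are given by a domain \<open>D\<close> and a total function that is only used on \<open>D\<close>.
  Self-adjointness is density, symmetry, and the inclusion of the domain of the adjoint in \<open>D\<close>.\<close>

definition selfadjoint_on :: "'a::real_inner set \<Rightarrow> ('a \<Rightarrow> 'a) \<Rightarrow> bool" where
  "selfadjoint_on D B \<longleftrightarrow>
     subspace D \<and> closure D = UNIV \<and>
     (\<forall>x\<in>D. \<forall>y\<in>D. B (x + y) = B x + B y) \<and> (\<forall>c. \<forall>x\<in>D. B (c *\<^sub>R x) = c *\<^sub>R B x) \<and>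
     (\<forall>x\<in>D. \<forall>y\<in>D. B x \<bullet> y = x \<bullet> B y) \<and>
     (\<forall>y. (\<exists>z. \<forall>x\<in>D. B x \<bullet> y = x \<bullet> z) \<longrightarrow> y \<in> D)"

definition strictly_positive_on :: "'a::real_inner set \<Rightarrow> ('a \<Rightarrow> 'a) \<Rightarrow> bool" where
  "strictly_positive_on D B \<longleftrightarrow> (\<forall>x\<in>D. x \<noteq> 0 \<longrightarrow> 0 < B x \<bullet> x)"

definition has_compact_inverse :: "'a::real_normed_vector set \<Rightarrow> ('a \<Rightarrow> 'a) \<Rightarrow> bool" where
  "has_compact_inverse D B \<longleftrightarrow>
     bij_betw B D UNIV \<and> compact (closure (inv_into D B ` cball 0 1))"

definition C0_semigroup :: "(real \<Rightarrow> 'a::real_normed_vector \<Rightarrow>\<^sub>L 'a) \<Rightarrow> bool" where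
  "C0_semigroup S \<longleftrightarrow>
     S 0 = id_blinfun \<and> (\<forall>s\<ge>0. \<forall>t\<ge>0. S (s + t) = S s o\<^sub>L S t) \<and>
     (\<forall>x. ((\<lambda>t. S t x) \<longlongrightarrow> x) (at_right 0))"

definition generates ::
    "'a::real_normed_vector set \<Rightarrow> ('a \<Rightarrow> 'a) \<Rightarrow> (real \<Rightarrow> 'a \<Rightarrow>\<^sub>L 'a) \<Rightarrow> bool" where
  "generates D A S \<longleftrightarrow>
     D = {x. \<exists>y. ((\<lambda>h. (S h x - x) /\<^sub>R h) \<longlongrightarrow> y) (at_right 0)} \<and>
     (\<forall>x\<in>D. ((\<lambda>h. (S h x - x) /\<^sub>R h) \<longlongrightarrow> A x) (at_right 0))"

text \<open>The spaces are real, so analyticity is a statement about the complexification, realised as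
  \<open>'a \<times> 'a\<close> with \<open>(x, y)\<close> standing for \<open>x + iy\<close>. Complex linearity of an operator is commutation with
  multiplication by \<open>i\<close>; the derivative of a holomorphic operator-valued function in direction \<open>h\<close> is
  \<open>h D = Re h D + Im h (iD)\<close>.\<close>

definition mult_i :: "('a::real_normed_vector \<times> 'a) \<Rightarrow>\<^sub>L ('a \<times> 'a)" where
  "mult_i = Blinfun (\<lambda>(x, y). (- y, x))"

definition sector :: "real \<Rightarrow> complex set" where
  "sector \<phi> = {z. z \<noteq> 0 \<and> \<bar>Arg z\<bar> < \<phi>}"

definition analytic_semigroup :: "(real \<Rightarrow> 'a::real_normed_vector \<Rightarrow>\<^sub>L 'a) \<Rightarrow> bool" where
  "analytic_semigroup S \<longleftrightarrow>
     (\<exists>\<phi> T. 0 < \<phi> \<and> \<phi> \<le> pi / 2 \<and>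
        (\<forall>z\<in>insert 0 (sector \<phi>). T z o\<^sub>L mult_i = mult_i o\<^sub>L T z) \<and>
        (\<forall>t\<ge>0. \<forall>x y. T (complex_of_real t) (x, y) = (S t x, S t y)) \<and>
        T 0 = id_blinfun \<and>
        (\<forall>z\<in>sector \<phi>. \<forall>w\<in>sector \<phi>. T (z + w) = T z o\<^sub>L T w) \<and>
        (\<forall>z\<in>sector \<phi>. \<exists>D. (T has_derivative
            (\<lambda>h. Re h *\<^sub>R D + Im h *\<^sub>R (mult_i o\<^sub>L D))) (at z)) \<and>
        (\<forall>p. ((\<lambda>z. T z p) \<longlongrightarrow> p) (at 0 within sector \<phi>)))"

text \<open>Fractional powers of \<open>-A\<close> through the semigroup generated by \<open>A\<close>: for \<open>\<gamma> > 0\<close> one puts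
  \<open>(-A)\<^bsup>-\<gamma>\<^esup> x = 1/\<Gamma>(\<gamma>) \<integral>\<^sub>0\<^bsup>\<infinity>\<^esup> t\<^bsup>\<gamma>-1\<^esup> S(t)x dt\<close>, which is injective for an exponentially decaying
  analytic semigroup, and takes \<open>(-A)\<^bsup>\<gamma>\<^esup>\<close> to be its inverse, with the range as domain. The norm
  of \<open>D((-A)\<^bsup>\<gamma>\<^esup>)\<close> is \<open>x \<mapsto> |(-A)\<^bsup>\<gamma>\<^esup> x|\<close>.\<close>

definition neg_frac_power ::
    "(real \<Rightarrow> 'a \<Rightarrow>\<^sub>L 'a) \<Rightarrow> real \<Rightarrow> 'a::{banach, second_countable_topology} \<Rightarrow> 'a" where
  "neg_frac_power S \<gamma> x = (LBINT t:{0<..}. t powr (\<gamma> - 1) *\<^sub>R S t x) /\<^sub>R Gamma \<gamma>"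

definition frac_dom ::
    "(real \<Rightarrow> 'a \<Rightarrow>\<^sub>L 'a) \<Rightarrow> real \<Rightarrow> 'a::{banach, second_countable_topology} set" where
  "frac_dom S \<gamma> = (if \<gamma> = 0 then UNIV else range (neg_frac_power S \<gamma>))"

definition frac_power ::
    "(real \<Rightarrow> 'a \<Rightarrow>\<^sub>L 'a) \<Rightarrow> real \<Rightarrow> 'a::{banach, second_countable_topology} \<Rightarrow> 'a" where
  "frac_power S \<gamma> = (if \<gamma> = 0 then id else inv (neg_frac_power S \<gamma>))"

text \<open>The space \<open>L(V;D((-A)\<^bsup>\<gamma>\<^esup>))\<close>, as a set of operators into the big space, and its norm.\<close>

definition L_frac :: "(real \<Rightarrow> 'a \<Rightarrow>\<^sub>L 'a) \<Rightarrow> real \<Rightarrow>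
    ('v::real_normed_vector \<Rightarrow>\<^sub>L 'a::{banach, second_countable_topology}) set" where
  "L_frac S \<gamma> = {T. range (blinfun_apply T) \<subseteq> frac_dom S \<gamma> \<and> bounded_linear (\<lambda>v. frac_power S \<gamma> (T v))}"

definition L_frac_norm :: "(real \<Rightarrow> 'a \<Rightarrow>\<^sub>L 'a) \<Rightarrow> real \<Rightarrow>
    ('v::real_normed_vector \<Rightarrow>\<^sub>L 'a::{banach, second_countable_topology}) \<Rightarrow> real" where
  "L_frac_norm S \<gamma> T = onorm (\<lambda>v. frac_power S \<gamma> (T v))"

section \<open>The noise\<close>

definition C0_paths :: "(real \<Rightarrow> 'u::real_normed_vector) set" where
  "C0_paths = {\<omega>. continuous_on UNIV \<omega> \<and> \<omega> 0 = 0}"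

definition compact_open_topology :: "(real \<Rightarrow> 'u::real_normed_vector) topology" where
  "compact_open_topology =
     topology_generated_by {{\<omega> \<in> C0_paths. \<omega> ` K \<subseteq> V} | K V. compact K \<and> open V}"

definition C0_borel :: "(real \<Rightarrow> 'u::real_normed_vector) measure" where
  "C0_borel = sigma C0_paths {W. openin compact_open_topology W}"

definition orthonormal_basis :: "'u::real_inner set \<Rightarrow> bool" where
  "orthonormal_basis E \<longleftrightarrow>
     (\<forall>e\<in>E. norm e = 1) \<and> pairwise orthogonal E \<and> closure (span E) = UNIV"

definition trace_class_covariance :: "('u::real_inner \<Rightarrow>\<^sub>L 'u) \<Rightarrow> bool" where
  "trace_class_covariance Q \<longleftrightarrow>
     (\<forall>u v. Q u \<bullet> v = u \<bullet> Q v) \<and> (\<forall>u. 0 \<le> Q u \<bullet> u) \<and>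
     (\<exists>E. orthonormal_basis E \<and> (\<lambda>e. Q e \<bullet> e) summable_on E)"

text \<open>\<open>N(0,v)\<close>, including the degenerate case of variance \<open>0\<close>.\<close>

definition centered_normal :: "real \<Rightarrow> real measure" where
  "centered_normal v =
     (if v = 0 then return borel 0 else density lborel (\<lambda>x. ennreal (normal_density 0 (sqrt v) x)))"

text \<open>Two-sided Wiener measure: under \<open>P\<close> the coordinate process has independent increments, and
  \<open>\<omega>(t) - \<omega>(s)\<close> has the law \<open>N(0,(t-s)Q)\<close>, i.e.\ its pairing with \<open>u\<close> is
  \<open>N(0,(t-s)\<langle>Qu,u\<rangle>)\<close>-distributed for every \<open>u\<close>.\<close>

definition wiener_measure ::
    "('u::{real_inner, banach, second_countable_topology} \<Rightarrow>\<^sub>L 'u) \<Rightarrow> (real \<Rightarrow> 'u) measure \<Rightarrow> bool" where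
  "wiener_measure Q P \<longleftrightarrow>
     prob_space P \<and> sets P = sets C0_borel \<and>
     (\<forall>s t u. s \<le> t \<longrightarrow>
        distr P borel (\<lambda>\<omega>. (\<omega> t - \<omega> s) \<bullet> u) = centered_normal ((t - s) * (Q u \<bullet> u))) \<and>
     (\<forall>(\<tau>::nat \<Rightarrow> real) n. mono \<tau> \<longrightarrow>
        prob_space.indep_vars P (\<lambda>_. borel) (\<lambda>i \<omega>. \<omega> (\<tau> (Suc i)) - \<omega> (\<tau> i)) {..<n})"

definition wiener_shift :: "real \<Rightarrow> (real \<Rightarrow> 'u::real_normed_vector) \<Rightarrow> (real \<Rightarrow> 'u)" where
  "wiener_shift t \<omega> = (\<lambda>s. \<omega> (s + t) - \<omega> t)"

definition finite_hoelder_seminorm ::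
    "real \<Rightarrow> real \<Rightarrow> real \<Rightarrow> (real \<Rightarrow> 'u::real_normed_vector) \<Rightarrow> bool" where
  "finite_hoelder_seminorm \<beta> a b \<omega> \<longleftrightarrow>
     bdd_above {norm (\<omega> t - \<omega> s) / (t - s) powr \<beta> | s t. a \<le> s \<and> s < t \<and> t \<le> b}"

section \<open>Tempered families\<close>

text \<open>\<open>log\<^sup>+\<close> on the extended reals: the supremum of the norms over an unbounded set is \<open>\<infinity>\<close>.\<close>

definition log_plus :: "ereal \<Rightarrow> ereal" where
  "log_plus x = (if x = \<infinity> then \<infinity> else if x \<le> 1 then 0 else ereal (ln (real_of_ereal x)))"

text \<open>The collection \<open>\<D>\<close> for a probability space \<open>M\<close> of paths; values off \<open>space M\<close> are irrelevant. On the
  reals, \<^term>\<open>at_infinity\<close> is the filter of \<open>t \<rightarrow> \<plusminus>\<infinity>\<close>.\<close>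

definition tempered_families ::
    "real \<Rightarrow> (real \<Rightarrow> 'u::real_normed_vector) measure \<Rightarrow>
      ((real \<Rightarrow> 'u) \<Rightarrow> (real \<Rightarrow> 'h::real_normed_vector) set) set" where
  "tempered_families \<mu> M = {D.
     (\<forall>\<omega>\<in>space M. D \<omega> \<noteq> {} \<and> closedin (mtopology_of (C_metric \<mu>)) (D \<omega>)) \<and>
     (\<forall>y\<in>C_space \<mu>. (\<lambda>\<omega>. INF x\<in>D \<omega>. sup_norm \<mu> (\<lambda>s. x s - y s)) \<in> borel_measurable M) \<and>
     (\<forall>\<omega>\<in>space M.
        ((\<lambda>t. log_plus (SUP x\<in>D (wiener_shift t \<omega>). ereal (sup_norm \<mu> x)) / ereal \<bar>t\<bar>) \<longlongrightarrow> 0) at_infinity)}"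

definition absorbing_R ::
    "real \<Rightarrow> real \<Rightarrow> real \<Rightarrow> real \<Rightarrow> real \<Rightarrow> real \<Rightarrow> real \<Rightarrow> real \<Rightarrow>
      (real \<Rightarrow> 'u::real_normed_vector) \<Rightarrow> real" where
  "absorbing_R lam \<mu> \<nu> bC\<^sub>F C\<^sub>F C\<^sub>G C\<^sub>G\<^sub>\<nu> C\<^sub>K \<omega> =
    (let w = (\<lambda>r. sup_norm \<mu> (segment \<mu> \<omega> r));
         \<kappa> = lam - C\<^sub>F * exp (lam * \<mu>);
         I = (LBINT r=-\<infinity>..0. exp (lam * r) * w r);
         J = (LBINT r=-\<infinity>..0. exp (lam * r) / (- r) powr (1 - \<nu>) * w r)
     in C\<^sub>G * w 0 + bC\<^sub>F * exp (lam * \<mu>) / lam + C\<^sub>K * exp (lam * \<mu>) * I + C\<^sub>G\<^sub>\<nu> * J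
        + C\<^sub>F * exp (lam * \<mu>) *
          (C\<^sub>G * (LBINT r=-\<infinity>..0. exp (\<kappa> * r) * w r)
           + bC\<^sub>F * exp (lam * \<mu>) / (lam * \<kappa>)
           + 1 / \<kappa> * (C\<^sub>K * exp (lam * \<mu>) * I + C\<^sub>G\<^sub>\<nu> * J)))"

end

theory Submission
  imports Defs "HOL-Real_Asymp.Real_Asymp"
begin

text \<open>
  Write \<open>w(\<omega>,r)\<close> for the norm of the segment of \<open>\<omega>\<close> over the window \<open>[r-\<mu>,r]\<close>. The radius \<open>R(\<omega>)\<close> is
  a combination, with nonnegative coefficients, of the constant \<open>1\<close>, of \<open>w(\<omega>,0)\<close> and of integrals of
  \<open>w(\<omega>,\<cdot>)\<close> over the past against the kernels \<open>e\<^bsup>cr\<^esup>(-r)\<^bsup>p-1\<^esup>\<close> with \<open>c,p > 0\<close>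
  (\<open>absorbing_R_affine\<close>); the condition on \<open>\<mu>\<close> says exactly that the smallest of the rates,
  \<open>\<lambda> - C\<^sub>F e\<^bsup>\<lambda>\<mu>\<^esup>\<close>, is positive. Membership in the class of tempered families then rests on two facts.

  Growth. The increments of \<open>\<omega>\<close> over unit steps are \<open>o(|t|)\<close>, so telescoping gives
  \<open>|\<omega>(t)| \<le> C(1+t\<^sup>2)\<close> (\<open>path_quadratic_growth\<close>). Hence \<open>w(\<theta>\<^sub>t\<omega>,r) \<le> B(1+t\<^sup>2)(1+r\<^sup>2)\<close>: the
  dependence on \<open>t\<close> splits off as a factor, and what remains under the integral is a fixed
  kernel times \<open>1+r\<^sup>2\<close>, integrable by the Gamma integral. So \<open>R(\<theta>\<^sub>t\<omega>)\<close> grows at most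
  quadratically in \<open>t\<close>, and its logarithm divided by \<open>|t|\<close> tends to zero
  (\<open>log_plus_quadratic_tendsto\<close>). A quadratic bound is enough because temperedness
  only sees the logarithm.

  Measurability. The distance of \<open>y\<close> to the ball of radius \<open>\<rho>\<close> is \<open>max 0 (\<parallel>y\<parallel> - \<rho>)\<close>
  (\<open>INF_dist_zero_ball\<close>), so only \<open>R\<close> has to be measurable. By Fubini this follows from joint
  measurability of \<open>w\<close> in \<open>(\<omega>,r)\<close> (\<open>measurable_window_norm\<close>), a countable supremum of evaluations
  of continuous paths.
\<close>

section \<open>Balls around the zero history\<close>

lemma C_spaceD: "x \<in> C_space \<mu> \<Longrightarrow> continuous_on {-\<mu>..0} x"
  by (simp add: C_space_def)

lemma sup_norm_cong:
  assumes "\<And>s. s \<in> {-\<mu>..0} \<Longrightarrow> norm (x s) = norm (y s)"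
  shows "sup_norm \<mu> x = sup_norm \<mu> y"
  unfolding sup_norm_def by (rule SUP_cong) (use assms in auto)

lemma sup_norm_least:
  assumes "0 \<le> \<mu>" "\<And>s. s \<in> {-\<mu>..0} \<Longrightarrow> norm (x s) \<le> c"
  shows "sup_norm \<mu> x \<le> c"
  unfolding sup_norm_def by (rule cSUP_least) (use assms in auto)

lemma sup_norm_nonneg:
  assumes "0 \<le> \<mu>" "continuous_on {-\<mu>..0} x"
  shows "0 \<le> sup_norm \<mu> x"
  using norm_le_sup_norm[OF assms(2), of 0] assms(1) order_trans[OF norm_ge_zero] by auto

lemma restrict_in_C_space:
  assumes "continuous_on {-\<mu>..0} x"
  shows "restrict x {-\<mu>..0} \<in> C_space \<mu>"
  by (auto simp: C_space_def intro: continuous_on_eq[OF assms])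

abbreviation zero_ball :: "real \<Rightarrow> real \<Rightarrow> (real \<Rightarrow> 'a::real_normed_vector) set" where
  "zero_ball \<mu> \<rho> \<equiv> mcball_of (C_metric \<mu>) (restrict (\<lambda>_. 0) {-\<mu>..0}) \<rho>"

lemma zero_ball_iff:
  fixes x :: "real \<Rightarrow> 'a::real_normed_vector"
  assumes "0 \<le> \<mu>"
  shows "x \<in> zero_ball \<mu> \<rho> \<longleftrightarrow> x \<in> C_space \<mu> \<and> sup_norm \<mu> x \<le> \<rho>"
proof -
  have z: "restrict (\<lambda>_. 0 :: 'a) {-\<mu>..0} \<in> C_space \<mu>"
    by (rule restrict_in_C_space) simp
  have "sup_norm \<mu> (\<lambda>s. restrict (\<lambda>_. 0 :: 'a) {-\<mu>..0} s - x s) = sup_norm \<mu> x"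
    by (rule sup_norm_cong) simp
  then show ?thesis
    using assms z by auto
qed

lemma zero_in_zero_ball:
  assumes "0 \<le> \<mu>" "0 \<le> \<rho>"
  shows "restrict (\<lambda>_. 0 :: 'a::real_normed_vector) {-\<mu>..0} \<in> zero_ball \<mu> \<rho>"
  unfolding zero_ball_iff[OF assms(1)]
  using assms by (auto intro!: restrict_in_C_space sup_norm_least)

text \<open>This reduces measurability of the random distance to measurability of the random radius. It also
  holds in the trivial space, where \<open>\<parallel>y\<parallel> = 0\<close>.\<close>

lemma INF_dist_zero_ball:
  fixes y :: "real \<Rightarrow> 'a::real_normed_vector"
  assumes mu: "0 \<le> \<mu>" and rho: "0 \<le> \<rho>" and y: "y \<in> C_space \<mu>"
  shows "(INF x\<in>zero_ball \<mu> \<rho>. sup_norm \<mu> (\<lambda>s. x s - y s)) = max 0 (sup_norm \<mu> y - \<rho>)"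
proof (rule antisym)
  let ?N = "sup_norm \<mu> y"
  have cont: "continuous_on {-\<mu>..0} y" by (rule C_spaceD[OF y])
  have N: "0 \<le> ?N" by (rule sup_norm_nonneg[OF mu cont])
  have lower: "max 0 (?N - \<rho>) \<le> sup_norm \<mu> (\<lambda>s. x s - y s)" if "x \<in> zero_ball \<mu> \<rho>" for x
  proof -
    have x: "continuous_on {-\<mu>..0} x" "sup_norm \<mu> x \<le> \<rho>"
      using that mu by (auto simp: zero_ball_iff C_spaceD simp del: in_mcball_of)
    have d: "continuous_on {-\<mu>..0} (\<lambda>s. x s - y s)"
      by (intro continuous_intros x cont)
    have "?N \<le> sup_norm \<mu> (\<lambda>s. x s - y s) + \<rho>"
    proof (rule sup_norm_least[OF mu])
      fix s assume s: "s \<in> {-\<mu>..0}"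
      have "norm (y s) \<le> norm (x s - y s) + norm (x s)"
        by (metis add.commute norm_minus_commute norm_triangle_sub)
      then show "norm (y s) \<le> sup_norm \<mu> (\<lambda>s. x s - y s) + \<rho>"
        using norm_le_sup_norm[OF d s] norm_le_sup_norm[OF x(1) s] x(2) by linarith
    qed
    then show ?thesis
      using sup_norm_nonneg[OF mu d] by simp
  qed
  show "max 0 (?N - \<rho>) \<le> (INF x\<in>zero_ball \<mu> \<rho>. sup_norm \<mu> (\<lambda>s. x s - y s))"
    by (rule cINF_greatest) (use zero_in_zero_ball[OF mu rho] lower in auto)
  \<comment> \<open>The radial projection of \<open>y\<close> onto the ball attains the infimum.\<close>
  define c where "c = (if ?N \<le> \<rho> then 1 else \<rho> / ?N)"
  have c: "0 \<le> c" "c \<le> 1" "c * ?N \<le> \<rho>" "(1 - c) * ?N \<le> max 0 (?N - \<rho>)"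
    using rho N by (auto simp: c_def field_simps)
  define x where "x = restrict (\<lambda>s. c *\<^sub>R y s) {-\<mu>..0}"
  have "sup_norm \<mu> x \<le> c * ?N"
    by (rule sup_norm_least[OF mu])
       (auto simp: x_def c intro!: mult_left_mono norm_le_sup_norm[OF cont])
  then have x: "x \<in> zero_ball \<mu> \<rho>"
    unfolding zero_ball_iff[OF mu]
    using c by (auto simp: x_def intro!: restrict_in_C_space continuous_intros cont)
  have "sup_norm \<mu> (\<lambda>s. x s - y s) \<le> (1 - c) * ?N"
  proof (rule sup_norm_least[OF mu])
    fix s assume s: "s \<in> {-\<mu>..0}"
    have "x s - y s = (c - 1) *\<^sub>R y s"
      using s by (simp add: x_def algebra_simps)
    then have "norm (x s - y s) = (1 - c) * norm (y s)"
      using c by simp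
    also have "\<dots> \<le> (1 - c) * ?N"
      using c norm_le_sup_norm[OF cont s] by (intro mult_left_mono) auto
    finally show "norm (x s - y s) \<le> (1 - c) * ?N" .
  qed
  moreover have "bdd_below ((\<lambda>x. sup_norm \<mu> (\<lambda>s. x s - y s)) ` zero_ball \<mu> \<rho>)"
    by (rule bdd_belowI2[OF lower])
  ultimately show "(INF x\<in>zero_ball \<mu> \<rho>. sup_norm \<mu> (\<lambda>s. x s - y s)) \<le> max 0 (?N - \<rho>)"
    using cINF_lower[OF _ x, of "\<lambda>x. sup_norm \<mu> (\<lambda>s. x s - y s)"] c(4) by linarith
qed

section \<open>Quadratic growth of the paths\<close>

text \<open>Sublinear growth of the unit increments does not bound the path linearly: \<open>n\<close> steps of size at
  most \<open>N + n\<close> add up to something of order \<open>n\<^sup>2\<close>.\<close>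

lemma path_quadratic_growth:
  fixes \<omega> :: "real \<Rightarrow> 'u::real_normed_vector"
  assumes cont: "continuous_on UNIV \<omega>"
    and growth: "((\<lambda>t. (SUP s\<in>{-1..0}. norm (wiener_shift t \<omega> s)) / \<bar>t\<bar>) \<longlongrightarrow> 0) at_infinity"
  shows "\<exists>C\<ge>0. \<forall>t. norm (\<omega> t) \<le> C * (1 + t\<^sup>2)"
proof -
  have cont': "continuous_on X (\<lambda>s. norm (\<omega> (s + t) - \<omega> t))" for X t
    by (intro continuous_intros continuous_on_compose2[OF cont]) auto
  have step: "norm (\<omega> (t - 1) - \<omega> t) \<le> (SUP s\<in>{-1..0}. norm (wiener_shift t \<omega> s))" for t
  proof -
    have "bdd_above ((\<lambda>s. norm (\<omega> (s + t) - \<omega> t)) ` {-1..0})"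
      using compact_continuous_image[OF cont', of "{-1..0::real}"]
      by (simp add: bounded_imp_bdd_above compact_imp_bounded)
    from cSUP_upper[OF _ this, of "-1"] show ?thesis
      by (simp add: wiener_shift_def add.commute)
  qed
  have "\<forall>\<^sub>F t in at_infinity. (SUP s\<in>{-1..0}. norm (wiener_shift t \<omega> s)) / \<bar>t\<bar> < 1"
    by (rule order_tendstoD[OF growth]) simp
  then obtain b where b: "\<And>t. b \<le> norm t \<Longrightarrow> (SUP s\<in>{-1..0}. norm (wiener_shift t \<omega> s)) / \<bar>t\<bar> < 1"
    unfolding eventually_at_infinity by blast
  define N where "N = max b 1"
  have inc: "norm (\<omega> (t - 1) - \<omega> t) \<le> \<bar>t\<bar>" if "N \<le> \<bar>t\<bar>" for t
  proof -
    have "0 < \<bar>t\<bar>" using that by (auto simp: N_def)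
    then show ?thesis
      using step[of t] b[of t] that by (auto simp: N_def field_simps)
  qed
  \<comment> \<open>The radius is \<open>N + 1\<close> because, for \<open>t < 0\<close>, the step from \<open>t\<close> to \<open>t + 1\<close> is the increment
    attached to \<open>t + 1\<close>, and \<open>\<bar>t + 1\<bar> \<ge> N\<close> has to hold.\<close>
  have "compact (\<omega> ` {-(N+1)..N+1})"
    by (rule compact_continuous_image[OF continuous_on_subset[OF cont]]) auto
  then have "bounded (\<omega> ` {-(N+1)..N+1})"
    by (rule compact_imp_bounded)
  then obtain M where "\<forall>x\<in>\<omega> ` {-(N+1)..N+1}. norm x \<le> M"
    unfolding bounded_iff by (elim exE)
  then have M: "norm (\<omega> t) \<le> M" if "\<bar>t\<bar> \<le> N + 1" for t
    using that by (simp add: abs_le_iff)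
  have N: "1 \<le> N" by (simp add: N_def)
  have M0: "0 \<le> M" using M[of 0] N order_trans[OF norm_ge_zero] by auto
  have bound: "norm (\<omega> t) \<le> M + real n * (N + 1 + real n)" if "\<bar>t\<bar> \<le> N + 1 + real n" for n t
    using that
  proof (induction n arbitrary: t)
    case 0
    then show ?case using M by simp
  next
    case (Suc n)
    have mono: "M + real n * (N + 1 + real n) + (N + 1 + real (Suc n))
        \<le> M + real (Suc n) * (N + 1 + real (Suc n))"
      using N by (simp add: algebra_simps)
    consider "\<bar>t\<bar> \<le> N + 1 + real n" | "t > N + 1 + real n" | "t < - (N + 1 + real n)"
      by linarith
    then show ?case
    proof cases
      case 1
      then show ?thesis using Suc.IH[of t] mono N by simp
    next
      case 2
      have "norm (\<omega> t) \<le> norm (\<omega> (t - 1)) + norm (\<omega> (t - 1) - \<omega> t)"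
        by (metis norm_minus_commute norm_triangle_sub)
      moreover have "norm (\<omega> (t - 1)) \<le> M + real n * (N + 1 + real n)"
        by (rule Suc.IH) (use 2 Suc.prems N in auto)
      ultimately show ?thesis
        using inc[of t] 2 Suc.prems mono N by auto
    next
      case 3
      have "norm (\<omega> t) \<le> norm (\<omega> (t + 1)) + norm (\<omega> (t + 1 - 1) - \<omega> (t + 1))"
        using norm_triangle_sub[of "\<omega> t" "\<omega> (t + 1)"] by simp
      moreover have "norm (\<omega> (t + 1)) \<le> M + real n * (N + 1 + real n)"
        by (rule Suc.IH) (use 3 Suc.prems N in auto)
      ultimately show ?thesis
        using inc[of "t + 1"] 3 Suc.prems mono N by auto
    qed
  qed
  define C where "C = M + 4 * (N + 3)"
  have "norm (\<omega> t) \<le> C * (1 + t\<^sup>2)" for t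
  proof -
    define n where "n = nat \<lceil>\<bar>t\<bar>\<rceil>"
    have n: "\<bar>t\<bar> \<le> real n" "real n \<le> \<bar>t\<bar> + 1"
      by (auto simp: n_def)
    have "norm (\<omega> t) \<le> M + real n * (N + 1 + real n)"
      by (rule bound) (use n N in auto)
    also have "\<dots> \<le> M + (\<bar>t\<bar> + 1) * (N + 1 + (\<bar>t\<bar> + 1))"
      using n N by (intro add_left_mono mult_mono) auto
    also have "\<dots> \<le> M + (\<bar>t\<bar> + 1) * ((N + 3) * (\<bar>t\<bar> + 1))"
    proof (intro add_left_mono mult_left_mono)
      have "0 \<le> (N + 2) * \<bar>t\<bar>" using N by simp
      then show "N + 1 + (\<bar>t\<bar> + 1) \<le> (N + 3) * (\<bar>t\<bar> + 1)"
        by (simp add: algebra_simps)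
    qed simp
    also have "\<dots> = M + (N + 3) * (\<bar>t\<bar> + 1)\<^sup>2"
      by (simp add: power2_eq_square algebra_simps)
    also have "\<dots> \<le> M * (1 + t\<^sup>2) + (N + 3) * (4 * (1 + t\<^sup>2))"
    proof (intro add_mono mult_left_mono)
      show "M \<le> M * (1 + t\<^sup>2)" using M0 by (simp add: algebra_simps)
      show "(\<bar>t\<bar> + 1)\<^sup>2 \<le> 4 * (1 + t\<^sup>2)"
        using zero_le_power2[of "\<bar>t\<bar> - 1"] zero_le_power2[of t]
        unfolding power2_sum power2_diff power2_abs by simp
    qed (use N in auto)
    also have "\<dots> = C * (1 + t\<^sup>2)" by (simp add: C_def algebra_simps)
    finally show ?thesis .
  qed
  moreover have "0 \<le> C" using M0 N by (simp add: C_def)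
  ultimately show ?thesis by blast
qed

abbreviation window_norm :: "real \<Rightarrow> (real \<Rightarrow> 'u::real_normed_vector) \<Rightarrow> real \<Rightarrow> real" where
  "window_norm \<mu> \<omega> r \<equiv> sup_norm \<mu> (segment \<mu> \<omega> r)"

lemma continuous_on_segment:
  assumes "continuous_on UNIV \<omega>"
  shows "continuous_on {-\<mu>..0} (segment \<mu> \<omega> r)"
proof -
  have "continuous_on {-\<mu>..0} (\<lambda>s. \<omega> (r + s))"
    by (intro continuous_on_compose2[OF assms] continuous_intros) auto
  then show ?thesis
    by (rule continuous_on_eq) (simp add: segment_def)
qed

lemma window_norm_nonneg:
  assumes "0 \<le> \<mu>" "continuous_on UNIV \<omega>"
  shows "0 \<le> window_norm \<mu> \<omega> r"
  by (intro sup_norm_nonneg continuous_on_segment assms)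

text \<open>The product form of the bound, rather than a bound in \<open>1 + t\<^sup>2 + r\<^sup>2\<close>, lets the dependence on \<open>t\<close> be
  pulled out of integrals over \<open>r\<close>.\<close>

lemma window_norm_shift_le:
  fixes \<omega> :: "real \<Rightarrow> 'u::real_normed_vector"
  assumes mu: "0 \<le> \<mu>" and C: "0 \<le> C" and \<omega>: "\<And>t. norm (\<omega> t) \<le> C * (1 + t\<^sup>2)"
  shows "window_norm \<mu> (wiener_shift t \<omega>) r \<le> C * (4 + 3 * \<mu>\<^sup>2) * (1 + t\<^sup>2) * (1 + r\<^sup>2)"
proof (rule sup_norm_least[OF mu])
  fix s assume s: "s \<in> {-\<mu>..0}"
  have poly: "(1 + q) + (1 + T) \<le> (4 + 3 * m) * ((1 + T) * (1 + R))"
    if "q \<le> 3 * (R + m + T)" "0 \<le> R" "0 \<le> m" "0 \<le> T" for q R m T :: real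
  proof -
    define X where "X = 4 * (R * T) + 3 * (m * T) + 3 * (m * R) + 3 * (m * (R * T))"
    have "0 \<le> X"
      using that by (simp add: X_def)
    moreover have "(4 + 3 * m) * ((1 + T) * (1 + R)) = 4 + 4 * T + 4 * R + 3 * m + X"
      by (simp add: X_def algebra_simps)
    ultimately show ?thesis
      using that by simp
  qed
  have "s\<^sup>2 \<le> \<mu>\<^sup>2"
    using s mu by (auto simp: abs_le_square_iff[symmetric])
  moreover have "(r + s + t)\<^sup>2 \<le> 3 * (r\<^sup>2 + s\<^sup>2 + t\<^sup>2)"
    using zero_le_power2[of "r - s"] zero_le_power2[of "r - t"] zero_le_power2[of "s - t"]
    by (simp add: power2_eq_square algebra_simps)
  ultimately have "(r + s + t)\<^sup>2 \<le> 3 * (r\<^sup>2 + \<mu>\<^sup>2 + t\<^sup>2)"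
    by argo
  then have sq: "(1 + (r + s + t)\<^sup>2) + (1 + t\<^sup>2) \<le> (4 + 3 * \<mu>\<^sup>2) * ((1 + t\<^sup>2) * (1 + r\<^sup>2))"
    by (rule poly) simp_all
  have "norm (segment \<mu> (wiener_shift t \<omega>) r s) = norm (\<omega> (r + s + t) - \<omega> t)"
    using s by (simp add: segment_def wiener_shift_def)
  also have "\<dots> \<le> norm (\<omega> (r + s + t)) + norm (\<omega> t)"
    by (rule norm_triangle_ineq4)
  also have "\<dots> \<le> C * ((1 + (r + s + t)\<^sup>2) + (1 + t\<^sup>2))"
    using \<omega>[of "r + s + t"] \<omega>[of t] by (simp add: distrib_left)
  also have "\<dots> \<le> C * ((4 + 3 * \<mu>\<^sup>2) * ((1 + t\<^sup>2) * (1 + r\<^sup>2)))"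
    by (rule mult_left_mono[OF sq C])
  finally show "norm (segment \<mu> (wiener_shift t \<omega>) r s)
      \<le> C * (4 + 3 * \<mu>\<^sup>2) * (1 + t\<^sup>2) * (1 + r\<^sup>2)"
    by (simp add: mult.assoc)
qed

section \<open>Weighted integrals over the past\<close>

text \<open>The reflected density of the Gamma distribution up to normalisation. Taking \<open>p = 1\<close> gives the pure
  exponential weight, \<open>p = \<nu>\<close> the weight with the integrable singularity at \<open>0\<close>.\<close>

definition gamma_kernel :: "real \<Rightarrow> real \<Rightarrow> real \<Rightarrow> real" where
  "gamma_kernel c p r = indicator {..<0} r * (exp (c * r) * (- r) powr (p - 1))"

lemma gamma_kernel_nonneg: "0 \<le> gamma_kernel c p r"
  by (simp add: gamma_kernel_def)

lemma gamma_kernel_measurable [measurable]: "gamma_kernel c p \<in> borel_measurable borel"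
  unfolding gamma_kernel_def by measurable

lemma integrable_gamma_kernel:
  assumes "0 < c" "0 < p"
  shows "integrable lborel (gamma_kernel c p)"
proof -
  define f where "f = (\<lambda>t. indicator {0<..} t * (t powr (p - 1) / exp (c * t)) :: real)"
  have "(\<lambda>t. norm (complex_of_real t powr (complex_of_real p - 1) / of_real (exp (c * t))))
      absolutely_integrable_on {0<..}"
    by (intro set_integrable_norm absolutely_integrable_Gamma_integral) (use assms in auto)
  moreover have "(\<lambda>t. indicator {0<..} t *\<^sub>R
      norm (complex_of_real t powr (complex_of_real p - 1) / of_real (exp (c * t)))) = f"
    by (auto simp: f_def indicator_def norm_divide norm_powr_real_powr)
  ultimately have "integrable lebesgue f"
    unfolding set_integrable_def by simp
  then have "integrable lborel f"
    by (subst (asm) integrable_completion) (auto simp: f_def)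
  then have "integrable lborel (\<lambda>r. f (0 + (-1) * r))"
    by (rule lborel_integrable_real_affine) simp
  moreover have "(\<lambda>r. f (0 + (-1) * r)) = gamma_kernel c p"
    by (auto simp: f_def gamma_kernel_def indicator_def exp_minus field_simps)
  ultimately show ?thesis by simp
qed

lemma integrable_gamma_kernel_quadratic:
  assumes "0 < c" "0 < p"
  shows "integrable lborel (\<lambda>r. gamma_kernel c p r * (1 + r\<^sup>2))"
proof -
  \<comment> \<open>A factor \<open>r\<^sup>2\<close> only raises the exponent of the kernel by \<open>2\<close>.\<close>
  have "gamma_kernel c p r * (1 + r\<^sup>2) = gamma_kernel c p r + gamma_kernel c (p + 2) r" for r
    using powr_add[of "- r" "p - 1" 2]
    by (auto simp: gamma_kernel_def indicator_def algebra_simps)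
  then show ?thesis
    using assms by (simp add: integrable_gamma_kernel)
qed

definition weighted_past :: "real \<Rightarrow> real \<Rightarrow> real \<Rightarrow> (real \<Rightarrow> 'u::real_normed_vector) \<Rightarrow> real" where
  "weighted_past c p \<mu> \<omega> = (LINT r|lborel. gamma_kernel c p r * window_norm \<mu> \<omega> r)"

lemma weighted_past_nonneg:
  assumes "0 \<le> \<mu>" "continuous_on UNIV \<omega>"
  shows "0 \<le> weighted_past c p \<mu> \<omega>"
  unfolding weighted_past_def
  by (intro integral_nonneg_AE AE_I2 mult_nonneg_nonneg gamma_kernel_nonneg window_norm_nonneg assms)

lemma weighted_past_le:
  assumes "0 < c" "0 < p" "0 \<le> B" and w: "\<And>r. window_norm \<mu> \<omega> r \<le> B * (1 + r\<^sup>2)"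
  shows "weighted_past c p \<mu> \<omega> \<le> B * (LINT r|lborel. gamma_kernel c p r * (1 + r\<^sup>2))"
proof -
  have "weighted_past c p \<mu> \<omega> \<le> (LINT r|lborel. B * (gamma_kernel c p r * (1 + r\<^sup>2)))"
    unfolding weighted_past_def
  proof (rule integral_mono')
    show "gamma_kernel c p r * window_norm \<mu> \<omega> r \<le> B * (gamma_kernel c p r * (1 + r\<^sup>2))" for r
      using mult_left_mono[OF w[of r] gamma_kernel_nonneg[of c p r]] by (simp add: mult_ac)
    show "0 \<le> B * (gamma_kernel c p r * (1 + r\<^sup>2))" for r
      using assms gamma_kernel_nonneg[of c p r] by simp
  qed (intro integrable_mult_right integrable_gamma_kernel_quadratic assms)
  then show ?thesis by simp
qed

lemma LBINT_eq_weighted_past: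
  assumes "\<And>r. r < 0 \<Longrightarrow> k r = exp (c * r) * (- r) powr (p - 1)"
  shows "(LBINT r=-\<infinity>..0. k r * window_norm \<mu> \<omega> r) = weighted_past c p \<mu> \<omega>"
proof -
  have "einterval (-\<infinity>) 0 = {..<0}"
    by (auto simp: einterval_def)
  then show ?thesis
    unfolding weighted_past_def interval_lebesgue_integral_def set_lebesgue_integral_def
    by (simp, intro Bochner_Integration.integral_cong refl)
       (simp add: gamma_kernel_def assms split: split_indicator)
qed

text \<open>Nonnegativity, measurability and growth of the radius depend on the coefficients only through
  their signs, so the explicit formula is used once, here.\<close>

lemma absorbing_R_affine:
  assumes "0 < lam" "0 < lam - C\<^sub>F * exp (lam * \<mu>)" "0 \<le> bC\<^sub>F" "0 \<le> C\<^sub>F" "0 \<le> C\<^sub>G" "0 \<le> C\<^sub>G\<^sub>\<nu>" "0 \<le> C\<^sub>K"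
  obtains a b c d e where "0 \<le> a" "0 \<le> b" "0 \<le> c" "0 \<le> d" "0 \<le> e"
    "\<And>\<omega> :: real \<Rightarrow> 'u::real_normed_vector. absorbing_R lam \<mu> \<nu> bC\<^sub>F C\<^sub>F C\<^sub>G C\<^sub>G\<^sub>\<nu> C\<^sub>K \<omega> =
       a + b * window_norm \<mu> \<omega> 0 + c * weighted_past lam 1 \<mu> \<omega> + d * weighted_past lam \<nu> \<mu> \<omega>
         + e * weighted_past (lam - C\<^sub>F * exp (lam * \<mu>)) 1 \<mu> \<omega>"
proof -
  define E where "E = exp (lam * \<mu>)"
  define \<kappa> where "\<kappa> = lam - C\<^sub>F * E"
  have E: "0 < E" by (simp add: E_def)
  have \<kappa>: "0 < \<kappa>" using assms by (simp add: \<kappa>_def E_def)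
  have I: "(LBINT r=-\<infinity>..0. exp (k * r) * window_norm \<mu> \<omega> r) = weighted_past k 1 \<mu> \<omega>"
    for k and \<omega> :: "real \<Rightarrow> 'u"
    by (rule LBINT_eq_weighted_past) simp
  have J: "(LBINT r=-\<infinity>..0. exp (lam * r) / (- r) powr (1 - \<nu>) * window_norm \<mu> \<omega> r)
      = weighted_past lam \<nu> \<mu> \<omega>" for \<omega> :: "real \<Rightarrow> 'u"
  proof (rule LBINT_eq_weighted_past)
    fix r :: real
    show "exp (lam * r) / (- r) powr (1 - \<nu>) = exp (lam * r) * (- r) powr (\<nu> - 1)"
      using powr_minus_divide[of "- r" "1 - \<nu>"] by simp
  qed
  show thesis
  proof (rule that)
    show "absorbing_R lam \<mu> \<nu> bC\<^sub>F C\<^sub>F C\<^sub>G C\<^sub>G\<^sub>\<nu> C\<^sub>K \<omega> =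
       (bC\<^sub>F * E / lam + C\<^sub>F * E * (bC\<^sub>F * E / (lam * \<kappa>))) + C\<^sub>G * window_norm \<mu> \<omega> 0
         + (C\<^sub>K * E * (1 + C\<^sub>F * E / \<kappa>)) * weighted_past lam 1 \<mu> \<omega>
         + (C\<^sub>G\<^sub>\<nu> * (1 + C\<^sub>F * E / \<kappa>)) * weighted_past lam \<nu> \<mu> \<omega>
         + (C\<^sub>F * E * C\<^sub>G) * weighted_past (lam - C\<^sub>F * exp (lam * \<mu>)) 1 \<mu> \<omega>"
      for \<omega> :: "real \<Rightarrow> 'u"
      unfolding absorbing_R_def Let_def I J E_def[symmetric] \<kappa>_def[symmetric]
      by (simp add: algebra_simps)
  qed (use assms E \<kappa> in auto)
qed

section \<open>Measurable dependence on the path\<close>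

lemma space_C0_borel: "space C0_borel = C0_paths"
  by (simp add: C0_borel_def space_measure_of_conv)

text \<open>The sets of paths that map the compact set \<open>{t}\<close> into an open set belong to the subbasis of the
  compact-open topology.\<close>

lemma measurable_evaluation:
  "(\<lambda>\<omega>. \<omega> t) \<in> borel_measurable (C0_borel :: (real \<Rightarrow> 'u::real_normed_vector) measure)"
proof (rule borel_measurableI)
  fix V :: "'u set" assume V: "open V"
  have sub: "{W. openin compact_open_topology W} \<subseteq> Pow (C0_paths :: (real \<Rightarrow> 'u) set)"
  proof clarify
    fix W :: "(real \<Rightarrow> 'u) set" and \<omega>
    assume "openin compact_open_topology W" "\<omega> \<in> W"
    then have "\<omega> \<in> topspace compact_open_topology"
      using openin_subset by blast
    then show "\<omega> \<in> C0_paths"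
      unfolding compact_open_topology_def topology_generated_by_topspace by auto
  qed
  have "openin compact_open_topology {\<omega> \<in> C0_paths. \<omega> ` {t} \<subseteq> V}"
    unfolding compact_open_topology_def
  proof (rule topology_generated_by_Basis, rule CollectI, intro exI conjI)
    show "compact {t}" by simp
  qed (use V in simp_all)
  moreover have "{\<omega> \<in> C0_paths. \<omega> ` {t} \<subseteq> V} = (\<lambda>\<omega>. \<omega> t) -` V \<inter> space C0_borel"
    by (auto simp: space_C0_borel)
  ultimately show "(\<lambda>\<omega>. \<omega> t) -` V \<inter> space C0_borel \<in> sets C0_borel"
    using sub by (auto simp: C0_borel_def sets_measure_of)
qed

text \<open>A map that is measurable in \<open>\<omega>\<close> and continuous in \<open>t\<close> is jointly measurable: it is the limit of
  the evaluations at \<open>\<lfloor>nt\<rfloor>/n\<close>, which take countably many values in time.\<close>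

lemma measurable_joint_evaluation:
  fixes N :: "(real \<Rightarrow> 'u::{real_normed_vector, second_countable_topology}) measure"
  assumes ev: "\<And>t. (\<lambda>\<omega>. \<omega> t) \<in> borel_measurable N"
    and cont: "\<And>\<omega>. \<omega> \<in> space N \<Longrightarrow> continuous_on UNIV \<omega>"
  shows "(\<lambda>p. fst p (snd p)) \<in> borel_measurable (N \<Otimes>\<^sub>M borel)"
proof (rule borel_measurable_LIMSEQ_metric)
  fix n :: nat
  note ev[measurable]
  show "(\<lambda>p. fst p (of_int \<lfloor>real (Suc n) * snd p\<rfloor> / real (Suc n))) \<in> borel_measurable (N \<Otimes>\<^sub>M borel)"
    by (rule measurable_compose_countable[where f="\<lambda>i p. fst p (of_int i / real (Suc n))"
          and g="\<lambda>p. \<lfloor>real (Suc n) * snd p\<rfloor>"]) measurable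
next
  fix p assume "p \<in> space (N \<Otimes>\<^sub>M (borel :: real measure))"
  then have "continuous_on UNIV (fst p)"
    by (auto simp: space_pair_measure cont)
  then have "isCont (fst p) (snd p)"
    by (simp add: continuous_on_eq_continuous_at)
  moreover have "(\<lambda>n. of_int \<lfloor>real (Suc n) * snd p\<rfloor> / real (Suc n)) \<longlonglongrightarrow> snd p"
    by real_asymp
  ultimately show "(\<lambda>n. fst p (of_int \<lfloor>real (Suc n) * snd p\<rfloor> / real (Suc n))) \<longlonglongrightarrow> fst p (snd p)"
    by (rule isCont_tendsto_compose)
qed

text \<open>A supremum over a countable set of times is needed for measurability. The rationals are taken in
  the open interval so that their closure is the whole window, whether or not \<open>\<mu>\<close> is rational.\<close>

lemma sup_norm_eq_SUP_Rats:
  fixes x :: "real \<Rightarrow> 'a::real_normed_vector"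
  assumes mu: "0 < \<mu>" and x: "continuous_on {-\<mu>..0} x"
  shows "sup_norm \<mu> x = (SUP s\<in>{-\<mu><..<0} \<inter> \<rat>. norm (x s))"
proof (rule antisym)
  have ne: "{-\<mu><..<0} \<inter> \<rat> \<noteq> {}"
    using Rats_dense_in_real[of "-\<mu>" 0] mu by auto
  have bdd: "bdd_above ((\<lambda>s. norm (x s)) ` ({-\<mu><..<0} \<inter> \<rat>))"
    by (rule bdd_above_mono[OF bdd_above_norm_C_space[OF x]]) auto
  have cl: "closure ({-\<mu><..<0} \<inter> \<rat>) = {-\<mu>..0}"
    using closure_open_Int_superset[of "{-\<mu><..<0}" \<rat>] mu
    by (simp add: Rats_closure_real)
  show "sup_norm \<mu> x \<le> (SUP s\<in>{-\<mu><..<0} \<inter> \<rat>. norm (x s))"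
  proof (rule sup_norm_least)
    fix s assume s: "s \<in> {-\<mu>..0}"
    show "norm (x s) \<le> (SUP s\<in>{-\<mu><..<0} \<inter> \<rat>. norm (x s))"
      by (rule continuous_le_on_closure[where S="{-\<mu><..<0} \<inter> \<rat>" and f="\<lambda>s. norm (x s)"])
         (use s cl in \<open>auto intro!: continuous_intros x cSUP_upper[OF _ bdd]\<close>)
  qed (use mu in simp)
  show "(SUP s\<in>{-\<mu><..<0} \<inter> \<rat>. norm (x s)) \<le> sup_norm \<mu> x"
    by (rule cSUP_least[OF ne]) (auto intro!: norm_le_sup_norm x)
qed

lemma measurable_window_norm:
  fixes N :: "(real \<Rightarrow> 'u::{real_normed_vector, second_countable_topology}) measure"
  assumes mu: "0 < \<mu>" and ev: "\<And>t. (\<lambda>\<omega>. \<omega> t) \<in> borel_measurable N"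
    and cont: "\<And>\<omega>. \<omega> \<in> space N \<Longrightarrow> continuous_on UNIV \<omega>"
  shows "(\<lambda>p. window_norm \<mu> (fst p) (snd p)) \<in> borel_measurable (N \<Otimes>\<^sub>M borel)"
proof -
  let ?S = "{-\<mu><..<0} \<inter> \<rat>"
  have eq: "window_norm \<mu> (fst p) (snd p) = (SUP s\<in>?S. norm (fst p (snd p + s)))"
    if "p \<in> space (N \<Otimes>\<^sub>M borel)" for p
  proof -
    have "window_norm \<mu> (fst p) (snd p) = (SUP s\<in>?S. norm (segment \<mu> (fst p) (snd p) s))"
      by (intro sup_norm_eq_SUP_Rats mu continuous_on_segment cont)
         (use that in \<open>auto simp: space_pair_measure\<close>)
    also have "\<dots> = (SUP s\<in>?S. norm (fst p (snd p + s)))"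
      by (intro SUP_cong) (auto simp: segment_def)
    finally show ?thesis .
  qed
  have "(\<lambda>p. SUP s\<in>?S. norm (fst p (snd p + s))) \<in> borel_measurable (N \<Otimes>\<^sub>M borel)"
  proof (rule borel_measurable_cSUP)
    show "countable ?S" by (simp add: countable_rat)
    fix s :: real
    have "(\<lambda>p. (fst p, snd p + s)) \<in> N \<Otimes>\<^sub>M borel \<rightarrow>\<^sub>M N \<Otimes>\<^sub>M borel"
      by measurable
    from measurable_compose[OF this measurable_joint_evaluation[OF ev cont]]
    have "(\<lambda>p. fst p (snd p + s)) \<in> borel_measurable (N \<Otimes>\<^sub>M borel)" by simp
    then show "(\<lambda>p. norm (fst p (snd p + s))) \<in> borel_measurable (N \<Otimes>\<^sub>M borel)"
      by measurable
  next
    fix p assume p: "p \<in> space (N \<Otimes>\<^sub>M (borel :: real measure))"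
    then have "continuous_on UNIV (fst p)" by (auto simp: space_pair_measure cont)
    from bdd_above_norm_C_space[OF continuous_on_segment[OF this, of \<mu> "snd p"]]
    have "bdd_above ((\<lambda>s. norm (fst p (snd p + s))) ` {-\<mu>..0})"
      by (simp add: segment_def)
    then show "bdd_above ((\<lambda>s. norm (fst p (snd p + s))) ` ?S)"
      by (rule bdd_above_mono) auto
  qed
  then show ?thesis
    by (rule measurable_cong[THEN iffD2, rotated]) (rule eq)
qed

lemma measurable_weighted_past:
  fixes N :: "(real \<Rightarrow> 'u::{real_normed_vector, second_countable_topology}) measure"
  assumes "0 < \<mu>" "\<And>t. (\<lambda>\<omega>. \<omega> t) \<in> borel_measurable N"
    and "\<And>\<omega>. \<omega> \<in> space N \<Longrightarrow> continuous_on UNIV \<omega>"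
  shows "weighted_past c p \<mu> \<in> borel_measurable N"
proof -
  have "sets (N \<Otimes>\<^sub>M lborel) = sets (N \<Otimes>\<^sub>M (borel :: real measure))"
    by (rule sets_pair_measure_cong) auto
  with measurable_window_norm[OF assms]
  have [measurable]: "(\<lambda>p. window_norm \<mu> (fst p) (snd p)) \<in> borel_measurable (N \<Otimes>\<^sub>M lborel)"
    by (simp cong: measurable_cong_sets)
  have "(\<lambda>(\<omega>, r). gamma_kernel c p r * window_norm \<mu> \<omega> r) \<in> borel_measurable (N \<Otimes>\<^sub>M lborel)"
    unfolding case_prod_beta by measurable
  then show ?thesis
    unfolding weighted_past_def by (rule lborel.borel_measurable_lebesgue_integral)
qed

section \<open>Logarithmic growth\<close>

lemma log_plus_ereal: "0 < C \<Longrightarrow> log_plus (ereal C) = ereal (ln (max 1 C))"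
  by (auto simp: log_plus_def max_def one_ereal_def)

lemma log_plus_mono:
  assumes "x \<le> y"
  shows "log_plus x \<le> log_plus y"
proof (cases y)
  case (real b)
  show ?thesis
  proof (cases x)
    case r: (real a)
    show ?thesis
      using assms real r by (auto simp: log_plus_def one_ereal_def)
  qed (use assms real in \<open>auto simp: log_plus_def one_ereal_def\<close>)
qed (use assms in \<open>auto simp: log_plus_def\<close>)

lemma log_plus_nonneg: "0 \<le> log_plus x"
  by (cases x) (auto simp: log_plus_def one_ereal_def)

lemma log_plus_quadratic_tendsto:
  fixes f :: "real \<Rightarrow> ereal"
  assumes f: "\<And>t. f t \<le> ereal (D * (1 + t\<^sup>2))"
  shows "((\<lambda>t. log_plus (f t) / ereal \<bar>t\<bar>) \<longlongrightarrow> 0) at_infinity"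
proof (rule tendsto_sandwich)
  define E where "E = max 1 D"
  have E: "0 < E" "1 \<le> E" by (auto simp: E_def)
  show "\<forall>\<^sub>F t in at_infinity. 0 \<le> log_plus (f t) / ereal \<bar>t\<bar>"
    using log_plus_nonneg by (intro always_eventually allI zero_le_divide_ereal) auto
  have "log_plus (f t) \<le> ereal (ln (E * (1 + t\<^sup>2)))" for t
  proof -
    have "D * (1 + t\<^sup>2) \<le> E * (1 + t\<^sup>2)" by (intro mult_right_mono) (auto simp: E_def)
    then have "log_plus (f t) \<le> log_plus (ereal (E * (1 + t\<^sup>2)))"
      by (intro log_plus_mono order_trans[OF f]) simp
    moreover have "1 * 1 \<le> E * (1 + t\<^sup>2)" using E by (intro mult_mono) auto
    ultimately show ?thesis using E by (simp add: log_plus_ereal max_def)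
  qed
  then have le: "log_plus (f t) / ereal \<bar>t\<bar> \<le> ereal (ln (E * (1 + t\<^sup>2)) / \<bar>t\<bar>)" if "t \<noteq> 0" for t
    using that by (metis abs_0_eq abs_ge_zero ereal_divide ereal_divide_right_mono ereal_less(2) less_eq_real_def)
  show "\<forall>\<^sub>F t in at_infinity. log_plus (f t) / ereal \<bar>t\<bar> \<le> ereal (ln (E * (1 + t\<^sup>2)) / \<bar>t\<bar>)"
    using eventually_not_equal_at_infinity[of 0] by eventually_elim (rule le)
  have "((\<lambda>t. ln (E * (1 + t\<^sup>2)) / \<bar>t\<bar>) \<longlongrightarrow> 0) at_infinity"
    unfolding at_infinity_eq_at_top_bot
  proof (rule filterlim_sup)
    show "((\<lambda>t. ln (E * (1 + t\<^sup>2)) / \<bar>t\<bar>) \<longlongrightarrow> 0) at_top" using E(1) by real_asymp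
    show "((\<lambda>t. ln (E * (1 + t\<^sup>2)) / \<bar>t\<bar>) \<longlongrightarrow> 0) at_bot" using E(1) by real_asymp
  qed
  then show "((\<lambda>t. ereal (ln (E * (1 + t\<^sup>2)) / \<bar>t\<bar>)) \<longlongrightarrow> 0) at_infinity"
    by (simp add: zero_ereal_def)
qed simp

section \<open>Temperedness of the absorbing balls\<close>

theorem lemma3p7:
  fixes \<mu> lam \<beta> \<nu> \<delta> bC\<^sub>F C\<^sub>F C\<^sub>G C\<^sub>G\<^sub>\<nu> C\<^sub>K :: real
    and D\<^sub>A :: "'h::{real_inner, banach, second_countable_topology} set"
    and A :: "'h \<Rightarrow> 'h"
    and S :: "real \<Rightarrow> 'h \<Rightarrow>\<^sub>L 'h"
    and Q :: "'u::{real_inner, banach, second_countable_topology} \<Rightarrow>\<^sub>L 'u"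
    and P :: "(real \<Rightarrow> 'u) measure"
    and \<Omega> :: "(real \<Rightarrow> 'u) set"
    and F :: "(real \<Rightarrow> 'h) \<Rightarrow> 'h"
    and G K :: "(real \<Rightarrow> 'h) \<Rightarrow> 'u \<Rightarrow>\<^sub>L 'h"
  assumes mu_pos: "\<mu> > 0"
    \<comment> \<open>the linear part\<close>
    and "selfadjoint_on D\<^sub>A (\<lambda>x. - A x)"
    and "strictly_positive_on D\<^sub>A (\<lambda>x. - A x)"
    and "has_compact_inverse D\<^sub>A (\<lambda>x. - A x)"
    and "C0_semigroup S" and "generates D\<^sub>A A S" and "analytic_semigroup S"
    and lam_pos: "lam > 0"
    and "\<And>t. t > 0 \<Longrightarrow> norm (S t) \<le> exp (- lam * t)"
    and "\<And>t \<gamma>. t > 0 \<Longrightarrow> \<gamma> \<in> {0..<1} \<Longrightarrow>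
           S t \<in> L_frac S \<gamma> \<and> L_frac_norm S \<gamma> (S t) \<le> t powr (- \<gamma>) * exp (- lam * t)"
    and "\<And>t \<theta> \<sigma> x. t > 0 \<Longrightarrow> \<theta> \<ge> 0 \<Longrightarrow> \<sigma> \<in> {\<theta>..1 + \<theta>} \<Longrightarrow> x \<in> frac_dom S \<sigma> \<Longrightarrow>
           S t x - x \<in> frac_dom S \<theta> \<and>
           norm (frac_power S \<theta> (S t x - x)) \<le> t powr (\<sigma> - \<theta>) * norm (frac_power S \<sigma> x)"
    \<comment> \<open>the noise\<close>
    and "trace_class_covariance Q"
    and wiener: "wiener_measure Q P"
    and "\<beta> \<in> {0<..<1/2}"
    and Omega_sets: "\<Omega> \<in> sets P" and "emeasure P \<Omega> = 1"
    and Omega_invariant: "\<And>t. wiener_shift t ` \<Omega> = \<Omega>"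
    and "\<And>\<omega> k. \<omega> \<in> \<Omega> \<Longrightarrow> finite_hoelder_seminorm \<beta> (- real k) (real k) \<omega>"
    and Omega_growth: "\<And>\<omega> a. \<omega> \<in> \<Omega> \<Longrightarrow> a < 0 \<Longrightarrow>
           ((\<lambda>t. (SUP s\<in>{a..0}. norm (wiener_shift t \<omega> s)) / \<bar>t\<bar>) \<longlongrightarrow> 0) at_infinity"
    \<comment> \<open>the coefficients\<close>
    and "Lipschitz_continuous_map (C_metric \<mu>) euclidean_metric F"
    and "bC\<^sub>F \<ge> 0" and "C\<^sub>F > 0"
    and "\<And>x. x \<in> C_space \<mu> \<Longrightarrow> norm (F x) \<le> bC\<^sub>F + C\<^sub>F * sup_norm \<mu> x"
    and "\<nu> \<in> {0<..<1}"
    and "\<And>x. x \<in> C_space \<mu> \<Longrightarrow> G x \<in> L_frac S \<nu>"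
    and "\<exists>L. \<forall>x\<in>C_space \<mu>. \<forall>y\<in>C_space \<mu>.
           L_frac_norm S \<nu> (G x - G y) \<le> L * sup_norm \<mu> (\<lambda>s. x s - y s)"
    and "\<And>x. x \<in> C_space \<mu> \<Longrightarrow> L_frac_norm S \<nu> (G x) \<le> C\<^sub>G\<^sub>\<nu>"
    and "\<And>x. x \<in> C_space \<mu> \<Longrightarrow> norm (G x) \<le> C\<^sub>G"
    and "Lipschitz_continuous_map (C_metric \<mu>) euclidean_metric K"
    and "\<And>x. x \<in> C_space \<mu> \<Longrightarrow> norm (K x) \<le> C\<^sub>K"
    and "\<And>T u. T > 0 \<Longrightarrow> continuous_on {-\<mu>..T} u \<Longrightarrow>
           continuous_on {0..T} (\<lambda>t. K (segment \<mu> u t)) \<and>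
           (\<forall>t\<in>{0..T}. ((\<lambda>t. G (segment \<mu> u t)) has_vector_derivative K (segment \<mu> u t))
              (at t within {0..T}))"
    and "\<mu> < 1 / lam * ln (lam / C\<^sub>F)"
    and "\<delta> > 0"
  shows "(\<lambda>\<omega>. mcball_of (C_metric \<mu>) (restrict (\<lambda>_. 0 :: 'h) {-\<mu>..0})
            (absorbing_R lam \<mu> \<nu> bC\<^sub>F C\<^sub>F C\<^sub>G C\<^sub>G\<^sub>\<nu> C\<^sub>K \<omega> + \<delta>))
         \<in> tempered_families \<mu> (restrict_space P \<Omega>)"
proof -
  let ?R = "absorbing_R lam \<mu> \<nu> bC\<^sub>F C\<^sub>F C\<^sub>G C\<^sub>G\<^sub>\<nu> C\<^sub>K :: (real \<Rightarrow> 'u) \<Rightarrow> real"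
  define M where "M = restrict_space P \<Omega>"
  define \<kappa> where "\<kappa> = lam - C\<^sub>F * exp (lam * \<mu>)"
  have mu: "0 \<le> \<mu>" using mu_pos by simp
  have CF: "0 < C\<^sub>F" by fact
  \<comment> \<open>Exponentiating the condition on \<open>\<mu>\<close> makes the rate \<open>\<kappa>\<close> positive.\<close>
  have "lam * \<mu> < ln (lam / C\<^sub>F)"
    using \<open>\<mu> < 1 / lam * ln (lam / C\<^sub>F)\<close> lam_pos by (simp add: field_simps)
  then have "exp (lam * \<mu>) < lam / C\<^sub>F"
    using lam_pos CF by (metis divide_pos_pos exp_less_cancel_iff exp_ln)
  then have kappa: "0 < \<kappa>"
    using CF by (simp add: \<kappa>_def field_simps)
  have z: "restrict (\<lambda>_. 0 :: 'h) {-\<mu>..0} \<in> C_space \<mu>"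
    by (rule restrict_in_C_space) simp
  \<comment> \<open>The bounds on \<open>G\<close> and \<open>K\<close> at the zero history force their constants to be nonnegative.\<close>
  have CG: "0 \<le> C\<^sub>G" and CK: "0 \<le> C\<^sub>K"
    using assms z by (meson norm_ge_zero order_trans)+
  have CGnu: "0 \<le> C\<^sub>G\<^sub>\<nu>"
  proof -
    have "0 \<le> L_frac_norm S \<nu> (G (restrict (\<lambda>_. 0) {-\<mu>..0}))"
      unfolding L_frac_norm_def
      by (rule onorm_pos_le) (use assms z in \<open>auto simp: L_frac_def\<close>)
    then show ?thesis using assms z by (meson order_trans)
  qed
  obtain a b c d e where coeffs: "0 \<le> a" "0 \<le> b" "0 \<le> c" "0 \<le> d" "0 \<le> e"
    and R: "\<And>\<omega> :: real \<Rightarrow> 'u. ?R \<omega> =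
       a + b * window_norm \<mu> \<omega> 0 + c * weighted_past lam 1 \<mu> \<omega> + d * weighted_past lam \<nu> \<mu> \<omega>
         + e * weighted_past \<kappa> 1 \<mu> \<omega>"
    using absorbing_R_affine[of lam C\<^sub>F \<mu> bC\<^sub>F C\<^sub>G C\<^sub>G\<^sub>\<nu> C\<^sub>K \<nu>, where ?'u='u]
      lam_pos kappa \<open>0 \<le> bC\<^sub>F\<close> CF CG CGnu CK
    unfolding \<kappa>_def by (metis less_imp_le)
  have nu: "0 < \<nu>" using \<open>\<nu> \<in> {0<..<1}\<close> by simp

  have sets_P: "sets P = sets C0_borel" using wiener by (simp add: wiener_measure_def)
  have "space P = C0_paths"
    using sets_eq_imp_space_eq[OF sets_P] by (simp add: space_C0_borel)
  then have Omega_sub: "\<Omega> \<subseteq> C0_paths"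
    using sets.sets_into_space[OF Omega_sets] by simp
  have space_M: "space M = \<Omega>"
    using Omega_sub \<open>space P = C0_paths\<close> by (auto simp: M_def space_restrict_space)
  have cont: "continuous_on UNIV \<omega>" if "\<omega> \<in> \<Omega>" for \<omega>
    using that Omega_sub by (auto simp: C0_paths_def)
  have ev: "(\<lambda>\<omega>. \<omega> t) \<in> borel_measurable M" for t
    unfolding M_def
    by (rule measurable_restrict_space1) (simp add: measurable_evaluation sets_P cong: measurable_cong_sets)

  have R_nonneg: "0 \<le> ?R \<omega>" if "\<omega> \<in> \<Omega>" for \<omega>
    unfolding R
    by (intro add_nonneg_nonneg mult_nonneg_nonneg coeffs window_norm_nonneg weighted_past_nonneg
        mu cont that)

  have wp: "weighted_past k p \<mu> \<in> borel_measurable M" for k p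
    by (intro measurable_weighted_past mu_pos ev cont) (simp add: space_M)
  have "(\<lambda>\<omega>. (\<omega>, 0 :: real)) \<in> M \<rightarrow>\<^sub>M M \<Otimes>\<^sub>M borel"
    by measurable
  from measurable_compose[OF this measurable_window_norm[OF mu_pos ev cont]]
  have w0: "(\<lambda>\<omega>. window_norm \<mu> \<omega> 0) \<in> borel_measurable M"
    by (simp add: space_M)
  have R_meas: "?R \<in> borel_measurable M"
    unfolding R by (intro borel_measurable_add borel_measurable_times borel_measurable_const wp w0)

  have growth: "\<exists>D. \<forall>t. ?R (wiener_shift t \<omega>) + \<delta> \<le> D * (1 + t\<^sup>2)" if \<omega>: "\<omega> \<in> \<Omega>" for \<omega>
  proof -
    obtain C where C: "0 \<le> C" "\<And>t. norm (\<omega> t) \<le> C * (1 + t\<^sup>2)"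
      using path_quadratic_growth[OF cont[OF \<omega>] Omega_growth[OF \<omega>, of "-1"]] by auto
    define B where "B = C * (4 + 3 * \<mu>\<^sup>2)"
    define V where "V k p = (LINT r|lborel. gamma_kernel k p r * (1 + r\<^sup>2))" for k p
    have B: "0 \<le> B" using C by (simp add: B_def)
    have w: "window_norm \<mu> (wiener_shift t \<omega>) r \<le> B * (1 + t\<^sup>2) * (1 + r\<^sup>2)" for t r
      unfolding B_def by (rule window_norm_shift_le[OF mu C])
    have wp_le: "weighted_past k p \<mu> (wiener_shift t \<omega>) \<le> B * (1 + t\<^sup>2) * V k p"
      if "0 < k" "0 < p" for k p t
      unfolding V_def using B by (intro weighted_past_le that w) auto
    have "?R (wiener_shift t \<omega>) + \<delta>
        \<le> (a + B * (b + c * V lam 1 + d * V lam \<nu> + e * V \<kappa> 1) + \<delta>) * (1 + t\<^sup>2)" for t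
    proof -
      have "?R (wiener_shift t \<omega>) + \<delta> \<le> a + b * (B * (1 + t\<^sup>2)) + c * (B * (1 + t\<^sup>2) * V lam 1)
          + d * (B * (1 + t\<^sup>2) * V lam \<nu>) + e * (B * (1 + t\<^sup>2) * V \<kappa> 1) + \<delta>"
        unfolding R using w[of t 0]
        by (intro add_mono mult_left_mono coeffs wp_le order_refl lam_pos kappa nu) auto
      also have "\<dots> \<le> a * (1 + t\<^sup>2) + b * (B * (1 + t\<^sup>2)) + c * (B * (1 + t\<^sup>2) * V lam 1)
          + d * (B * (1 + t\<^sup>2) * V lam \<nu>) + e * (B * (1 + t\<^sup>2) * V \<kappa> 1) + \<delta> * (1 + t\<^sup>2)"
        using coeffs(1) \<open>\<delta> > 0\<close> by (intro add_mono order_refl) (auto simp: algebra_simps)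
      finally show ?thesis by (simp add: algebra_simps)
    qed
    then show ?thesis by blast
  qed

  show ?thesis
    unfolding tempered_families_def M_def[symmetric] mem_Collect_eq
  proof (intro conjI ballI)
    fix \<omega> assume "\<omega> \<in> space M"
    then have \<omega>: "\<omega> \<in> \<Omega>" by (simp add: space_M)
    show "zero_ball \<mu> (?R \<omega> + \<delta>) \<noteq> ({} :: (real \<Rightarrow> 'h) set)"
      using zero_in_zero_ball[OF mu, of "?R \<omega> + \<delta>"] R_nonneg[OF \<omega>] \<open>\<delta> > 0\<close> by fastforce
    show "closedin (mtopology_of (C_metric \<mu>)) (zero_ball \<mu> (?R \<omega> + \<delta>) :: (real \<Rightarrow> 'h) set)"
      by (simp add: mcball_of_def mtopology_of_def Metric_space.closedin_mcball)
    obtain D where D: "\<And>t. ?R (wiener_shift t \<omega>) + \<delta> \<le> D * (1 + t\<^sup>2)"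
      using growth[OF \<omega>] by blast
    show "((\<lambda>t. log_plus (SUP x\<in>zero_ball \<mu> (?R (wiener_shift t \<omega>) + \<delta>) :: (real \<Rightarrow> 'h) set.
        ereal (sup_norm \<mu> x)) / ereal \<bar>t\<bar>) \<longlongrightarrow> 0) at_infinity"
    proof (rule log_plus_quadratic_tendsto)
      show "(SUP x\<in>zero_ball \<mu> (?R (wiener_shift t \<omega>) + \<delta>) :: (real \<Rightarrow> 'h) set. ereal (sup_norm \<mu> x))
          \<le> ereal (D * (1 + t\<^sup>2))" for t
        using order_trans[OF _ D[of t]] by (intro SUP_least) (auto simp: zero_ball_iff[OF mu] simp del: in_mcball_of)
    qed
  next
    fix y :: "real \<Rightarrow> 'h" assume y: "y \<in> C_space \<mu>"
    have eq: "(INF x\<in>zero_ball \<mu> (?R \<omega> + \<delta>). sup_norm \<mu> (\<lambda>s. x s - y s))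
        = max 0 (sup_norm \<mu> y - (?R \<omega> + \<delta>))" if "\<omega> \<in> space M" for \<omega>
      using R_nonneg[of \<omega>] that \<open>\<delta> > 0\<close> by (intro INF_dist_zero_ball[OF mu _ y]) (auto simp: space_M)
    have "(\<lambda>\<omega>. max 0 (sup_norm \<mu> y - (?R \<omega> + \<delta>))) \<in> borel_measurable M"
      using R_meas by measurable
    then show "(\<lambda>\<omega>. INF x\<in>zero_ball \<mu> (?R \<omega> + \<delta>). sup_norm \<mu> (\<lambda>s. x s - y s)) \<in> borel_measurable M"
      by (rule measurable_cong[THEN iffD2, rotated]) (rule eq)
  qed
qed

end
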